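(* Let $\Omega\subset\mathbb{R}^d$ be open and bounded, $Y$ a real Hilbert space, $A:L^1(\Omega)\to Y$ a bounded linear operator, $y\in Y$, $c>0$, $\lambda=\frac1c$, $m\in\{0,1\}$, and $u_0\in\mathrm{dom}\,\partial f$. Consider the iteration $$u_{k+1}\in\arg\min_{u\in\mathrm{dom}\,f}\left\{\langle Au-y,Au_k-y\rangle+c\,d(u,u_k)+\chi_m(u)\right\},\qquad k=0,1,2,\dots$$ Then for every $k\ge0$ there exists a unique minimizer $u_{k+1}$ in this problem, given by $$u_{k+1}=u_k\,c_k^m\,e^{\lambda A^*(y-Au_k)},\qquad c_k^0=1,\qquad c_k^1=\frac{1}{\int_\Omega u_k\,e^{\lambda A^*(y-Au_k)}\,dt},$$ and $u_{k+1}\in\mathrm{dom}\,\partial f$.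
   Context: $f:L^1(\Omega)\to(-\infty,+\infty]$ is the negative Boltzmann-Shannon entropy: $f(u)=\int_\Omega u(t)\ln u(t)\,dt$ if $u\ge 0$ a.e. and $u\ln u\in L^1(\Omega)$, and $f(u)=+\infty$ otherwise (with $0\ln 0=0$). $\mathrm{dom}\,f=\{u\in L^1(\Omega): f(u)<\infty\}$. $\mathrm{dom}\,\partial f$ denotes the set of $u\in L^1(\Omega)$ that are (nonnegative,) essentially bounded and bounded away from zero a.e., i.e. $0<\alpha\le u\le\beta<\infty$ a.e. for some constants $\alpha,\beta$. For $v,u\in\mathrm{dom}\,f$ the Kullback-Leibler divergence is $d(v,u)=\int_\Omega\big[v(t)\ln\frac{v(t)}{u(t)}-v(t)+u(t)\big]dt\in[0,+\infty]$. $\chi_0\equiv 0$; $\chi_1(u)=0$ if $\int_\Omega u(t)\,dt=1$ and $\chi_1(u)=+\infty$ otherwise. $A^*:Y\to L^\infty(\Omega)$ is the adjoint of $A$ (identifying $Y^*$ with $Y$ and $L^1(\Omega)^*$ with $L^\infty(\Omega)$); the inner product in the iteration is that of $Y$. *)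

theory Defs
  imports "HOL-Analysis.Analysis"
begin

text \<open>Elements of \<open>L\<^sup>1(\<Omega>)\<close> and \<open>L\<^sup>\<infinity>(\<Omega>)\<close> are represented by functions; two functions denote the
  same element iff they agree almost everywhere on \<open>\<Omega>\<close>. All notions below are invariant under this
  identification.\<close>

definition L1 :: "(real ^ 'd) set \<Rightarrow> ((real ^ 'd) \<Rightarrow> real) set" where
  "L1 \<Omega> = {u. integrable (lebesgue_on \<Omega>) u}"

definition Linf :: "(real ^ 'd) set \<Rightarrow> ((real ^ 'd) \<Rightarrow> real) set" where
  "Linf \<Omega> = {g \<in> borel_measurable (lebesgue_on \<Omega>).
     \<exists>C. AE t in lebesgue_on \<Omega>. \<bar>g t\<bar> \<le> C}"

text \<open>Linearity and the norm bound force \<open>A u = A v\<close> whenever \<open>u = v\<close> almost everywhere, so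
  such an \<open>A\<close> is an operator on equivalence classes.\<close>

definition bounded_linear_L1 ::
  "(real ^ 'd) set \<Rightarrow> (((real ^ 'd) \<Rightarrow> real) \<Rightarrow> 'y::real_normed_vector) \<Rightarrow> bool" where
  "bounded_linear_L1 \<Omega> A \<longleftrightarrow>
     (\<forall>u\<in>L1 \<Omega>. \<forall>v\<in>L1 \<Omega>. A (\<lambda>t. u t + v t) = A u + A v) \<and>
     (\<forall>r. \<forall>u\<in>L1 \<Omega>. A (\<lambda>t. r * u t) = r *\<^sub>R A u) \<and>
     (\<exists>K. \<forall>u\<in>L1 \<Omega>. norm (A u) \<le> K * (\<integral>t. \<bar>u t\<bar> \<partial>lebesgue_on \<Omega>))"

text \<open>A representative of the class \<open>A\<^sup>* z \<in> L\<^sup>\<infinity>(\<Omega>)\<close>. For \<open>A\<close> bounded and linear it exists, and is unique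
  up to null sets, by the duality of \<open>L\<^sup>1(\<Omega>)\<close> and \<open>L\<^sup>\<infinity>(\<Omega>)\<close>.\<close>

definition adjoint_L1 ::
  "(real ^ 'd) set \<Rightarrow> (((real ^ 'd) \<Rightarrow> real) \<Rightarrow> 'y::real_inner) \<Rightarrow> 'y \<Rightarrow> (real ^ 'd) \<Rightarrow> real" where
  "adjoint_L1 \<Omega> A z = (SOME g. g \<in> Linf \<Omega> \<and>
     (\<forall>u\<in>L1 \<Omega>. (\<integral>t. u t * g t \<partial>lebesgue_on \<Omega>) = A u \<bullet> z))"

definition neg_entropy :: "(real ^ 'd) set \<Rightarrow> ((real ^ 'd) \<Rightarrow> real) \<Rightarrow> ereal" where
  "neg_entropy \<Omega> u =
     (if (AE t in lebesgue_on \<Omega>. 0 \<le> u t) \<and> integrable (lebesgue_on \<Omega>) (\<lambda>t. u t * ln (u t))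
      then ereal (\<integral>t. u t * ln (u t) \<partial>lebesgue_on \<Omega>) else \<infinity>)"

definition dom_entropy :: "(real ^ 'd) set \<Rightarrow> ((real ^ 'd) \<Rightarrow> real) set" where
  "dom_entropy \<Omega> = {u \<in> L1 \<Omega>. neg_entropy \<Omega> u < \<infinity>}"

definition dom_subdiff_entropy :: "(real ^ 'd) set \<Rightarrow> ((real ^ 'd) \<Rightarrow> real) set" where
  "dom_subdiff_entropy \<Omega> =
     {u \<in> L1 \<Omega>. \<exists>\<alpha> \<beta>. 0 < \<alpha> \<and> (AE t in lebesgue_on \<Omega>. \<alpha> \<le> u t \<and> u t \<le> \<beta>)}"

text \<open>The integrand \<open>a ln (a / b) - a + b\<close> for \<open>a, b \<ge> 0\<close>, with \<open>0 ln (0 / b) = 0\<close> and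
  \<open>a ln (a / 0) = \<infinity>\<close> for \<open>a > 0\<close>. It is nonnegative, so the conversion to \<^typ>\<open>ennreal\<close> cuts nothing off.\<close>

definition kl_integrand :: "real \<Rightarrow> real \<Rightarrow> ennreal" where
  "kl_integrand a b =
     (if b = 0 \<and> a \<noteq> 0 then \<infinity> else ennreal (a * ln (a / b) - a + b))"

definition KL :: "(real ^ 'd) set \<Rightarrow> ((real ^ 'd) \<Rightarrow> real) \<Rightarrow> ((real ^ 'd) \<Rightarrow> real) \<Rightarrow> ennreal" where
  "KL \<Omega> v u = (\<integral>\<^sup>+ t. kl_integrand (v t) (u t) \<partial>lebesgue_on \<Omega>)"

definition chi :: "(real ^ 'd) set \<Rightarrow> nat \<Rightarrow> ((real ^ 'd) \<Rightarrow> real) \<Rightarrow> ereal" where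
  "chi \<Omega> m u = (if m = 0 then 0 else if (\<integral>t. u t \<partial>lebesgue_on \<Omega>) = 1 then 0 else \<infinity>)"

text \<open>\<open>w\<close> minimizes \<open>\<langle>A u - y, A v - y\<rangle> + c d(u, v) + \<chi>\<^sub>m(u)\<close> over \<open>u\<close> in the domain of the entropy.\<close>

definition is_step ::
  "(real ^ 'd) set \<Rightarrow> (((real ^ 'd) \<Rightarrow> real) \<Rightarrow> 'y::real_inner) \<Rightarrow> 'y \<Rightarrow> real \<Rightarrow> nat
     \<Rightarrow> ((real ^ 'd) \<Rightarrow> real) \<Rightarrow> ((real ^ 'd) \<Rightarrow> real) \<Rightarrow> bool" where
  "is_step \<Omega> A y c m v w \<longleftrightarrow>
     is_arg_min (\<lambda>u. ereal ((A u - y) \<bullet> (A v - y)) + ereal c * enn2ereal (KL \<Omega> u v) + chi \<Omega> m u)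
       (\<lambda>u. u \<in> dom_entropy \<Omega>) w"

definition step_const ::
  "(real ^ 'd) set \<Rightarrow> (((real ^ 'd) \<Rightarrow> real) \<Rightarrow> 'y::real_inner) \<Rightarrow> 'y \<Rightarrow> real \<Rightarrow> nat
     \<Rightarrow> ((real ^ 'd) \<Rightarrow> real) \<Rightarrow> real" where
  "step_const \<Omega> A y l m v =
     (if m = 0 then 1
      else 1 / (\<integral>t. v t * exp (l * adjoint_L1 \<Omega> A (y - A v) t) \<partial>lebesgue_on \<Omega>))"

end

theory Submission
  imports Defs
begin

text \<open>Write \<open>v = u\<^sub>k\<close> and let \<open>w\<close> be the claimed minimizer. Since
  \<open>ln w = ln v + ln c\<^sub>k + \<lambda> A\<^sup>*(y - A v)\<close> is bounded, the linear term of the objective can be absorbed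
  into the divergence: on the feasible set the objective equals \<open>c d(u, w)\<close> plus a constant. As
  \<open>d(u, w) \<ge> 0\<close> with equality only for \<open>u = w\<close> almost everywhere, \<open>w\<close> is the unique minimizer.\<close>

section \<open>Duality of L1 and L-infinity over a finite measure\<close>

lemma integrable_mult_AE_bounded:
  fixes u g :: "'a \<Rightarrow> real"
  assumes u: "integrable M u" and [measurable]: "g \<in> borel_measurable M"
    and C: "AE t in M. \<bar>g t\<bar> \<le> C"
  shows "integrable M (\<lambda>t. u t * g t)"
proof (rule Bochner_Integration.integrable_bound)
  show "integrable M (\<lambda>t. C * u t)"
    using u by simp
  show "(\<lambda>t. u t * g t) \<in> borel_measurable M"
    using borel_measurable_integrable[OF u] by measurable
  show "AE t in M. norm (u t * g t) \<le> norm (C * u t)"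
    using C
  proof eventually_elim
    case (elim t)
    then have "\<bar>u t\<bar> * \<bar>g t\<bar> \<le> \<bar>u t\<bar> * \<bar>C\<bar>"
      by (intro mult_left_mono) auto
    then show ?case
      by (simp add: abs_mult mult.commute)
  qed
qed

text \<open>Multiples of indicators generate the integrable functions under sums and dominated
  limits, and \<open>bound\<close> makes \<open>\<phi>\<close> continuous along such limits. It is
  applied to the difference of two functionals, whose equality then has to be checked on indicators
  only.\<close>

lemma L1_functional_eq_0:
  fixes \<phi> :: "('a \<Rightarrow> real) \<Rightarrow> real"
  assumes add: "\<And>u v. integrable M u \<Longrightarrow> integrable M v \<Longrightarrow> \<phi> (\<lambda>x. u x + v x) = \<phi> u + \<phi> v"
    and scale: "\<And>r u. integrable M u \<Longrightarrow> \<phi> (\<lambda>x. r * u x) = r * \<phi> u"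
    and bound: "\<And>u. integrable M u \<Longrightarrow> \<bar>\<phi> u\<bar> \<le> K * (\<integral>x. \<bar>u x\<bar> \<partial>M)"
    and indicator: "\<And>E. E \<in> sets M \<Longrightarrow> emeasure M E < \<infinity> \<Longrightarrow> \<phi> (indicator E) = 0"
    and u: "integrable M u"
  shows "\<phi> u = 0"
  using u
proof (induction u rule: integrable_induct)
  case (base E c)
  then show ?case
    using scale[of "indicator E" c] indicator[of E] by (simp add: mult.commute)
next
  case (add f g)
  then show ?case
    using assms(1)[of f g] by simp
next
  case (lim f s)
  \<comment> \<open>The induction rule bounds the approximants by twice the norm of
    \<open>f\<close>, so the triangle inequality yields the dominating function with factor
    3.\<close>
  have 1: "(\<lambda>i. \<integral>x. \<bar>f x - s i x\<bar> \<partial>M) \<longlonglongrightarrow> (\<integral>x. 0 \<partial>M)"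
  proof (rule integral_dominated_convergence[where w = "\<lambda>x. 3 * \<bar>f x\<bar>"])
    show "AE x in M. (\<lambda>i. \<bar>f x - s i x\<bar>) \<longlonglongrightarrow> 0"
    proof (rule AE_I2)
      fix x assume "x \<in> space M"
      from tendsto_diff[OF tendsto_const[of "f x"] lim(2)[OF this]]
      show "(\<lambda>i. \<bar>f x - s i x\<bar>) \<longlonglongrightarrow> 0"
        by (intro tendsto_rabs_zero) simp
    qed
    show "AE x in M. norm \<bar>f x - s i x\<bar> \<le> 3 * \<bar>f x\<bar>" for i
      using lim(3)[of _ i] by (intro AE_I2) fastforce
  qed (use lim in \<open>auto intro!: borel_measurable_integrable\<close>)
  \<comment> \<open>By the induction hypothesis \<open>\<phi>\<close> vanishes at
    \<open>s i\<close>, so \<open>f\<close> may be replaced by \<open>f - s i\<close> inside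
    \<open>\<phi>\<close>.\<close>
  have "\<bar>\<phi> f\<bar> \<le> K * (\<integral>x. \<bar>f x - s i x\<bar> \<partial>M)" for i
  proof -
    have "\<phi> (\<lambda>x. f x - s i x) = \<phi> f"
      using assms(1)[of f "\<lambda>x. - 1 * s i x"] scale[of "s i" "-1"] lim by simp
    then show ?thesis
      using bound[of "\<lambda>x. f x - s i x"] lim by simp
  qed
  then have "\<bar>\<phi> f\<bar> \<le> K * (\<integral>x. 0 \<partial>M)"
    by (intro LIMSEQ_le_const[OF tendsto_mult[OF tendsto_const 1]]) auto
  then show ?case by simp
qed

text \<open>The set function \<open>E \<mapsto> \<phi> 1\<^sub>E\<close> is a signed measure; adding \<open>K\<close> times the measure \<open>M\<close> makes it
  nonnegative, so that the theorem of Radon and Nikodym for positive measures applies.\<close>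

lemma (in finite_measure) L1_functional_representation:
  fixes \<phi> :: "('a \<Rightarrow> real) \<Rightarrow> real"
  assumes add: "\<And>u v. integrable M u \<Longrightarrow> integrable M v \<Longrightarrow> \<phi> (\<lambda>x. u x + v x) = \<phi> u + \<phi> v"
    and scale: "\<And>r u. integrable M u \<Longrightarrow> \<phi> (\<lambda>x. r * u x) = r * \<phi> u"
    and bound: "\<And>u. integrable M u \<Longrightarrow> \<bar>\<phi> u\<bar> \<le> K * (\<integral>x. \<bar>u x\<bar> \<partial>M)"
  obtains g where "g \<in> borel_measurable M" "AE x in M. \<bar>g x\<bar> \<le> \<bar>K\<bar>"
    "\<And>u. integrable M u \<Longrightarrow> (\<integral>x. u x * g x \<partial>M) = \<phi> u"
proof -
  define L where "L = \<bar>K\<bar>"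
  define \<nu> where "\<nu> E = \<phi> (indicator E) + L * measure M E" for E
  have ind: "integrable M (indicator E :: 'a \<Rightarrow> real)" if "E \<in> sets M" for E
    using that by (simp add: emeasure_eq_measure)
  have b: "\<bar>\<phi> u\<bar> \<le> L * (\<integral>x. \<bar>u x\<bar> \<partial>M)" if "integrable M u" for u
    by (rule order_trans[OF bound[OF that] mult_right_mono]) (simp_all add: L_def)
  \<comment> \<open>Both bounds come from \<open>b\<close> at the indicator of \<open>E\<close>. The
    upper one is used three times: for continuity at the empty set, for absolute continuity and for
    the bound on the density.\<close>
  have \<nu>: "0 \<le> \<nu> E" "\<nu> E \<le> 2 * L * measure M E" if "E \<in> sets M" for E
    using b[OF ind[OF that]] that by (auto simp: \<nu>_def)
  have \<nu>_Un: "\<nu> (E \<union> F) = \<nu> E + \<nu> F" if "E \<in> sets M" "F \<in> sets M" "E \<inter> F = {}" for E F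
  proof -
    have "(\<lambda>x. indicator E x + indicator F x :: real) = indicator (E \<union> F)"
      using that by (auto simp: fun_eq_iff indicator_def)
    then show ?thesis
      using add[OF ind ind, of E F] that
      by (simp add: \<nu>_def finite_measure_Union algebra_simps)
  qed
  have \<nu>_empty: "\<nu> {} = 0"
    using \<nu>[of "{}"] by simp
  define N where "N = measure_of (space M) (sets M) (\<lambda>E. ennreal (\<nu> E))"
  have sN: "sets N = sets M" "space N = space M"
    by (auto simp: N_def)
  have pos: "positive (sets M) (\<lambda>E. ennreal (\<nu> E))"
    by (simp add: positive_def \<nu>_empty)
  \<comment> \<open>Finite additivity is known, so continuity along sequences decreasing to the
    empty set suffices; there \<open>\<nu>\<close> is squeezed between 0 and
    \<open>2 * L * measure M\<close>.\<close>
  have ca: "countably_additive (sets M) (\<lambda>E. ennreal (\<nu> E))"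
  proof (rule sets.empty_continuous_imp_countably_additive[OF pos])
    show "additive (sets M) (\<lambda>E. ennreal (\<nu> E))"
      by (auto simp: additive_def \<nu>_Un \<nu> ennreal_plus)
    fix B :: "nat \<Rightarrow> 'a set"
    assume B: "range B \<subseteq> sets M" "decseq B" "(\<Inter>i. B i) = {}"
    have "(\<lambda>i. measure M (B i)) \<longlonglongrightarrow> 0"
      using finite_Lim_measure_decseq[OF B(1,2)] B(3) by simp
    then have "(\<lambda>i. 2 * L * measure M (B i)) \<longlonglongrightarrow> 0"
      by (rule tendsto_mult_right_zero)
    then have "(\<lambda>i. \<nu> (B i)) \<longlonglongrightarrow> 0"
      by (rule tendsto_sandwich[OF _ _ tendsto_const, rotated -1])
        (use B(1) \<nu> in \<open>auto intro!: always_eventually\<close>)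
    then show "(\<lambda>i. ennreal (\<nu> (B i))) \<longlonglongrightarrow> 0"
      using tendsto_ennrealI by fastforce
  qed simp_all
  have emN: "emeasure N E = ennreal (\<nu> E)" if "E \<in> sets M" for E
    using emeasure_measure_of_sigma[OF sets.sigma_algebra_axioms pos ca that] by (simp add: N_def)
  have "absolutely_continuous M N"
  proof (unfold absolutely_continuous_def, rule subsetI)
    fix E assume "E \<in> null_sets M"
    then have "E \<in> sets M" "measure M E = 0"
      by (auto simp: null_sets_def measure_def)
    then show "E \<in> null_sets N"
      using \<nu>[of E] by (auto simp: null_sets_def sN emN)
  qed
  then obtain f where f[measurable]: "f \<in> borel_measurable M" and fN: "density M f = N"
    using Radon_Nikodym[of N] sN by auto
  have fE: "(\<integral>\<^sup>+x. f x * indicator E x \<partial>M) = ennreal (\<nu> E)" if "E \<in> sets M" for E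
    using emeasure_density[OF f that] emN[OF that] fN by simp
  have fle: "AE x in M. f x \<le> ennreal (2 * L)"
  proof -
    \<comment> \<open>If the density exceeded \<open>2 * L\<close> on a non-null set, integrating
      over \<open>E\<close> would give a value of \<open>\<nu> E\<close> strictly above its upper
      bound.\<close>
    define E where "E = {x \<in> space M. ennreal (2 * L) < f x}"
    have [measurable]: "E \<in> sets M"
      unfolding E_def by measurable
    have int: "(\<integral>\<^sup>+x. ennreal (2 * L) * indicator E x \<partial>M) = ennreal (2 * L * measure M E)"
      by (simp add: nn_integral_cmult_indicator emeasure_eq_measure ennreal_mult'')
    have "AE x in M. f x * indicator E x \<le> ennreal (2 * L) * indicator E x"
    proof (rule ccontr)
      assume "\<not> ?thesis"
      then have "(\<integral>\<^sup>+x. ennreal (2 * L) * indicator E x \<partial>M) < (\<integral>\<^sup>+x. f x * indicator E x \<partial>M)"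
      proof (intro nn_integral_less)
        show "(\<integral>\<^sup>+x. ennreal (2 * L) * indicator E x \<partial>M) \<noteq> \<infinity>"
          unfolding int by simp
        show "AE x in M. ennreal (2 * L) * indicator E x \<le> f x * indicator E x"
          by (auto simp: E_def indicator_def)
      qed simp_all
      then show False
        using ennreal_leI[OF \<nu>(2)[of E]] by (simp add: int fE not_less flip: not_le)
    qed
    then show ?thesis
    proof (rule AE_mp, intro AE_I2 impI)
      fix x assume "x \<in> space M" "f x * indicator E x \<le> ennreal (2 * L) * indicator E x"
      then show "f x \<le> ennreal (2 * L)"
        by (cases "x \<in> E") (auto simp: E_def)
    qed
  qed
  \<comment> \<open>Subtracting \<open>L\<close> undoes the shift in \<open>\<nu>\<close> and turns
    the range from 0 to \<open>2 * L\<close> into the symmetric bound \<open>L\<close>.\<close>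
  define g where "g x = enn2real (f x) - L" for x
  have [measurable]: "g \<in> borel_measurable M"
    unfolding g_def by measurable
  have g_bound: "AE x in M. \<bar>g x\<bar> \<le> L"
    using fle
  proof eventually_elim
    case (elim x)
    then have "enn2real (f x) \<le> 2 * L"
      using enn2real_mono[OF elim] by (simp add: L_def)
    moreover have "0 \<le> enn2real (f x)"
      by simp
    ultimately show ?case
      unfolding g_def by linarith
  qed
  have g_ind: "(\<integral>x. indicator E x * g x \<partial>M) = \<phi> (indicator E)" if E[measurable]: "E \<in> sets M" for E
  proof -
    \<comment> \<open>The density is finite almost everywhere, so \<open>enn2real\<close> loses
      nothing under the integral.\<close>
    have "AE x in M. ennreal (indicator E x * enn2real (f x)) = f x * indicator E x"
      using fle
    proof eventually_elim
      case (elim x)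
      then have "f x < top"
        using ennreal_less_top le_less_trans by blast
      then show ?case
        by (simp add: indicator_def)
    qed
    then have "(\<integral>\<^sup>+x. ennreal (indicator E x * enn2real (f x)) \<partial>M) = ennreal (\<nu> E)"
      using fE[OF E] by (simp cong: nn_integral_cong_AE)
    then have hb: "has_bochner_integral M (\<lambda>x. indicator E x * enn2real (f x)) (\<nu> E)"
      using \<nu>(1)[OF E] by (intro has_bochner_integral_nn_integral) auto
    have "(\<integral>x. indicator E x * g x \<partial>M)
        = (\<integral>x. indicator E x * enn2real (f x) - L * indicator E x \<partial>M)"
      by (simp add: g_def algebra_simps)
    also have "\<dots> = \<nu> E - L * measure M E"
      using hb ind[OF E] by (simp add: has_bochner_integral_iff)
    finally show ?thesis
      by (simp add: \<nu>_def)
  qed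
  have gint: "integrable M (\<lambda>x. u x * g x)" if "integrable M u" for u
    using integrable_mult_AE_bounded[OF that _ g_bound] by simp
  \<comment> \<open>Integration against \<open>g\<close> and \<open>\<phi>\<close> agree on
    indicators. Each is bounded by \<open>L\<close> times the L1 norm, whence the constant
    \<open>2 * L\<close> for their difference.\<close>
  have "(\<integral>x. u x * g x \<partial>M) - \<phi> u = 0" if "integrable M u" for u
  proof (rule L1_functional_eq_0[where M = M and K = "2 * L" and \<phi> = "\<lambda>u. (\<integral>x. u x * g x \<partial>M) - \<phi> u"])
    fix u v :: "'a \<Rightarrow> real" assume "integrable M u" "integrable M v"
    then show "(\<integral>x. (u x + v x) * g x \<partial>M) - \<phi> (\<lambda>x. u x + v x)
        = (\<integral>x. u x * g x \<partial>M) - \<phi> u + ((\<integral>x. v x * g x \<partial>M) - \<phi> v)"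
      by (simp add: add gint distrib_right)
  next
    fix r and u :: "'a \<Rightarrow> real" assume "integrable M u"
    then show "(\<integral>x. (r * u x) * g x \<partial>M) - \<phi> (\<lambda>x. r * u x) = r * ((\<integral>x. u x * g x \<partial>M) - \<phi> u)"
      by (simp add: scale gint right_diff_distrib mult.assoc)
  next
    fix u :: "'a \<Rightarrow> real" assume u: "integrable M u"
    have "\<bar>\<integral>x. u x * g x \<partial>M\<bar> \<le> (\<integral>x. \<bar>u x * g x\<bar> \<partial>M)"
      by (rule integral_abs_bound)
    also have "\<dots> \<le> (\<integral>x. L * \<bar>u x\<bar> \<partial>M)"
    proof (rule integral_mono_AE)
      show "AE x in M. \<bar>u x * g x\<bar> \<le> L * \<bar>u x\<bar>"
        using g_bound by eventually_elim (simp add: abs_mult mult.commute mult_right_mono)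
    qed (use u gint in auto)
    finally have "\<bar>\<integral>x. u x * g x \<partial>M\<bar> \<le> L * (\<integral>x. \<bar>u x\<bar> \<partial>M)"
      by simp
    with b[OF u] show "\<bar>(\<integral>x. u x * g x \<partial>M) - \<phi> u\<bar> \<le> 2 * L * (\<integral>x. \<bar>u x\<bar> \<partial>M)"
      by linarith
  qed (use g_ind that in auto)
  then show ?thesis
    using that[of g] g_bound by (simp add: L_def)
qed

text \<open>By Cauchy-Schwarz, pairing \<open>A u\<close> with \<open>z\<close> is a bounded
  functional of \<open>u\<close> with constant \<open>K * norm z\<close>. Its density is a witness
  for the choice in the definition, so the chosen function has the defining properties.\<close>

lemma adjoint_L1:
  fixes A :: "((real ^ 'd) \<Rightarrow> real) \<Rightarrow> 'y::real_inner"
  assumes fin: "finite_measure (lebesgue_on \<Omega>)" and A: "bounded_linear_L1 \<Omega> A"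
  shows "adjoint_L1 \<Omega> A z \<in> Linf \<Omega>"
    and "u \<in> L1 \<Omega> \<Longrightarrow> (\<integral>t. u t * adjoint_L1 \<Omega> A z t \<partial>lebesgue_on \<Omega>) = A u \<bullet> z"
proof -
  let ?M = "lebesgue_on \<Omega>"
  interpret finite_measure ?M by (rule fin)
  from A obtain K where add: "\<And>u v. integrable ?M u \<Longrightarrow> integrable ?M v \<Longrightarrow> A (\<lambda>t. u t + v t) = A u + A v"
    and scale: "\<And>r u. integrable ?M u \<Longrightarrow> A (\<lambda>t. r * u t) = r *\<^sub>R A u"
    and K: "\<And>u. integrable ?M u \<Longrightarrow> norm (A u) \<le> K * (\<integral>t. \<bar>u t\<bar> \<partial>?M)"
    unfolding bounded_linear_L1_def L1_def by auto
  have "\<bar>A u \<bullet> z\<bar> \<le> K * norm z * (\<integral>t. \<bar>u t\<bar> \<partial>?M)" if "integrable ?M u" for u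
    using Cauchy_Schwarz_ineq2[of "A u" z] mult_right_mono[OF K[OF that], of "norm z"]
    by (simp add: ac_simps)
  then obtain g where "g \<in> borel_measurable ?M" "AE t in ?M. \<bar>g t\<bar> \<le> \<bar>K * norm z\<bar>"
    "\<And>u. integrable ?M u \<Longrightarrow> (\<integral>t. u t * g t \<partial>?M) = A u \<bullet> z"
    using L1_functional_representation[where \<phi> = "\<lambda>u. A u \<bullet> z" and K = "K * norm z"]
    by (auto simp: add scale inner_add_left)
  then have "g \<in> Linf \<Omega> \<and> (\<forall>u\<in>L1 \<Omega>. (\<integral>t. u t * g t \<partial>?M) = A u \<bullet> z)"
    by (auto simp: Linf_def L1_def)
  from someI[where P = "\<lambda>g. g \<in> Linf \<Omega> \<and> (\<forall>u\<in>L1 \<Omega>. (\<integral>t. u t * g t \<partial>?M) = A u \<bullet> z)", OF this]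
  show "adjoint_L1 \<Omega> A z \<in> Linf \<Omega>"
    and "u \<in> L1 \<Omega> \<Longrightarrow> (\<integral>t. u t * adjoint_L1 \<Omega> A z t \<partial>?M) = A u \<bullet> z"
    by (simp_all add: adjoint_L1_def)
qed


section \<open>The entropy domain and functions bounded away from 0 and infinity\<close>

lemma dom_entropy_iff:
  "u \<in> dom_entropy \<Omega> \<longleftrightarrow> integrable (lebesgue_on \<Omega>) u \<and> (AE t in lebesgue_on \<Omega>. 0 \<le> u t) \<and>
     integrable (lebesgue_on \<Omega>) (\<lambda>t. u t * ln (u t))"
  by (auto simp: dom_entropy_def L1_def neg_entropy_def)

lemma integrable_mult_Linf:
  assumes "integrable (lebesgue_on \<Omega>) u" and "g \<in> Linf \<Omega>"
  shows "integrable (lebesgue_on \<Omega>) (\<lambda>t. u t * g t)"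
  using assms integrable_mult_AE_bounded[of "lebesgue_on \<Omega>" u g] by (auto simp: Linf_def)

text \<open>Monotonicity of \<open>ln\<close> carries the two-sided bounds over. A bounded
  \<open>ln w\<close> is an admissible multiplier of every integrable function.\<close>

lemma ln_dom_subdiff_entropy:
  assumes w: "w \<in> dom_subdiff_entropy \<Omega>"
  shows "(\<lambda>t. ln (w t)) \<in> Linf \<Omega>"
proof -
  from w obtain \<alpha> \<beta> where \<alpha>: "0 < \<alpha>" and *: "AE t in lebesgue_on \<Omega>. \<alpha> \<le> w t \<and> w t \<le> \<beta>"
    and [measurable]: "w \<in> borel_measurable (lebesgue_on \<Omega>)"
    by (auto simp: dom_subdiff_entropy_def L1_def)
  have "AE t in lebesgue_on \<Omega>. \<bar>ln (w t)\<bar> \<le> \<bar>ln \<alpha>\<bar> + \<bar>ln \<beta>\<bar>"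
    using *
  proof eventually_elim
    case (elim t)
    then have "ln \<alpha> \<le> ln (w t)" "ln (w t) \<le> ln \<beta>"
      using \<alpha> by auto
    then show ?case
      by linarith
  qed
  then show ?thesis
    by (auto simp: Linf_def)
qed

lemma dom_subdiff_entropy_pos:
  "w \<in> dom_subdiff_entropy \<Omega> \<Longrightarrow> AE t in lebesgue_on \<Omega>. 0 < w t"
  unfolding dom_subdiff_entropy_def by (auto elim: eventually_mono)

lemma dom_subdiff_entropy_subset: "dom_subdiff_entropy \<Omega> \<subseteq> dom_entropy \<Omega>"
proof
  fix w assume w: "w \<in> dom_subdiff_entropy \<Omega>"
  then have "integrable (lebesgue_on \<Omega>) w"
    by (simp add: dom_subdiff_entropy_def L1_def)
  moreover have "AE t in lebesgue_on \<Omega>. 0 \<le> w t"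
    using dom_subdiff_entropy_pos[OF w] by (auto elim: eventually_mono)
  ultimately show "w \<in> dom_entropy \<Omega>"
    using integrable_mult_Linf ln_dom_subdiff_entropy[OF w] by (auto simp: dom_entropy_iff)
qed

text \<open>A minimizer is determined only up to a null set; this transfers membership from the
  explicit formula to the actual iterate.\<close>

lemma dom_subdiff_entropy_cong_AE:
  assumes "w \<in> dom_subdiff_entropy \<Omega>" and "u \<in> L1 \<Omega>" and eq: "AE t in lebesgue_on \<Omega>. u t = w t"
  shows "u \<in> dom_subdiff_entropy \<Omega>"
proof -
  from assms(1) obtain \<alpha> \<beta> where "0 < \<alpha>" and *: "AE t in lebesgue_on \<Omega>. \<alpha> \<le> w t \<and> w t \<le> \<beta>"
    by (auto simp: dom_subdiff_entropy_def)
  moreover have "AE t in lebesgue_on \<Omega>. \<alpha> \<le> u t \<and> u t \<le> \<beta>"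
    using * eq by eventually_elim simp
  ultimately show ?thesis
    using assms(2) by (auto simp: dom_subdiff_entropy_def)
qed

text \<open>Split \<open>u ln (u / w)\<close> into \<open>u ln u\<close>, integrable by finite
  entropy, and \<open>u ln w\<close>, integrable since \<open>ln w\<close> is bounded.\<close>

lemma integrable_mult_ln_divide:
  assumes u: "u \<in> dom_entropy \<Omega>" and w: "w \<in> dom_subdiff_entropy \<Omega>"
  shows "integrable (lebesgue_on \<Omega>) (\<lambda>t. u t * ln (u t / w t))"
proof (rule integrable_cong_AE_imp)
  have int: "integrable (lebesgue_on \<Omega>) u" "integrable (lebesgue_on \<Omega>) (\<lambda>t. u t * ln (u t))"
    using u by (auto simp: dom_entropy_iff)
  show "integrable (lebesgue_on \<Omega>) (\<lambda>t. u t * ln (u t) - u t * ln (w t))"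
    using int integrable_mult_Linf[OF int(1) ln_dom_subdiff_entropy[OF w]] by simp
  have [measurable]: "u \<in> borel_measurable (lebesgue_on \<Omega>)" "w \<in> borel_measurable (lebesgue_on \<Omega>)"
    using u w by (auto simp: dom_entropy_iff dom_subdiff_entropy_def L1_def)
  show "(\<lambda>t. u t * ln (u t / w t)) \<in> borel_measurable (lebesgue_on \<Omega>)"
    by measurable
  have "AE t in lebesgue_on \<Omega>. 0 \<le> u t"
    using u by (simp add: dom_entropy_iff)
  then show "AE t in lebesgue_on \<Omega>. u t * ln (u t) - u t * ln (w t) = u t * ln (u t / w t)"
    using dom_subdiff_entropy_pos[OF w]
  proof eventually_elim
    case (elim t)
    \<comment> \<open>Where \<open>u t = 0\<close> both sides vanish through the factor
      \<open>u t\<close>; elsewhere both arguments of the quotient are positive.\<close>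
    then show ?case
      by (cases "u t = 0") (auto simp: ln_div right_diff_distrib)
  qed
qed

section \<open>The Kullback-Leibler divergence as a real integral\<close>

text \<open>For \<open>a > 0\<close> this is \<open>ln x \<le> x - 1\<close> at
  \<open>x = b / a\<close>, multiplied by \<open>a\<close>.\<close>

lemma kl_nonneg:
  fixes a b :: real
  assumes "0 \<le> a" "0 < b"
  shows "0 \<le> a * ln (a / b) - a + b"
proof (cases "a = 0")
  case False
  with assms have "ln (b / a) \<le> b / a - 1"
    by (intro ln_le_minus_one) simp
  then have "a * ln (b / a) \<le> a * (b / a - 1)"
    using assms(1) by (rule mult_left_mono)
  then show ?thesis
    using assms False by (simp add: ln_div algebra_simps)
qed (use assms in simp)

text \<open>Equality in \<open>ln x \<le> x - 1\<close> holds only at \<open>x = 1\<close>, here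
  \<open>x = b / a\<close>.\<close>

lemma kl_eq_0_imp_eq:
  fixes a b :: real
  assumes "0 \<le> a" "0 < b" and eq: "a * ln (a / b) - a + b = 0"
  shows "a = b"
proof (cases "a = 0")
  case False
  have "a * ln (b / a) = a * (b / a - 1)"
    using assms False by (simp add: ln_div algebra_simps)
  then have "ln (b / a) = b / a - 1"
    using False by simp
  then have "b / a = 1"
    using assms False by (intro ln_eq_minus_one) auto
  then show ?thesis
    using False by simp
qed (use eq in simp)

context
  fixes \<Omega> :: "(real ^ 'd) set" and u w :: "real ^ 'd \<Rightarrow> real"
  assumes u: "u \<in> dom_entropy \<Omega>" and w: "w \<in> dom_subdiff_entropy \<Omega>"
begin

lemma integrable_kl: "integrable (lebesgue_on \<Omega>) (\<lambda>t. u t * ln (u t / w t) - u t + w t)"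
proof -
  have "integrable (lebesgue_on \<Omega>) u" "integrable (lebesgue_on \<Omega>) w"
    using u w by (auto simp: dom_entropy_iff dom_subdiff_entropy_def L1_def)
  then show ?thesis
    using integrable_mult_ln_divide[OF u w] by simp
qed

lemma AE_kl_nonneg: "AE t in lebesgue_on \<Omega>. 0 \<le> u t * ln (u t / w t) - u t + w t"
proof -
  have "AE t in lebesgue_on \<Omega>. 0 \<le> u t"
    using u by (simp add: dom_entropy_iff)
  then show ?thesis
    using dom_subdiff_entropy_pos[OF w] by eventually_elim (rule kl_nonneg)
qed

text \<open>The infinite branch of \<open>kl_integrand\<close> is confined to the null set where
  \<open>w\<close> vanishes, and the remaining integrand is integrable and nonnegative almost
  everywhere. The divergence is therefore finite and can be handled in the reals.\<close>

lemma KL_eq_integral: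
  "enn2ereal (KL \<Omega> u w) = ereal (\<integral>t. u t * ln (u t / w t) - u t + w t \<partial>lebesgue_on \<Omega>)"
proof -
  have "KL \<Omega> u w = (\<integral>\<^sup>+t. ennreal (u t * ln (u t / w t) - u t + w t) \<partial>lebesgue_on \<Omega>)"
    unfolding KL_def using dom_subdiff_entropy_pos[OF w]
    by (intro nn_integral_cong_AE) (auto simp: kl_integrand_def elim: eventually_mono)
  also have "\<dots> = ennreal (\<integral>t. u t * ln (u t / w t) - u t + w t \<partial>lebesgue_on \<Omega>)"
    by (rule nn_integral_eq_integral[OF integrable_kl AE_kl_nonneg])
  finally show ?thesis
    using integral_nonneg_AE[OF AE_kl_nonneg] by (simp add: enn2ereal_ennreal)
qed

lemma integral_kl_nonneg: "0 \<le> (\<integral>t. u t * ln (u t / w t) - u t + w t \<partial>lebesgue_on \<Omega>)"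
  by (rule integral_nonneg_AE[OF AE_kl_nonneg])

text \<open>A nonnegative integrand with zero integral vanishes almost everywhere, and the pointwise
  equality case applies. Uniqueness of the minimizer rests on this.\<close>

lemma integral_kl_eq_0_imp_AE_eq:
  assumes "(\<integral>t. u t * ln (u t / w t) - u t + w t \<partial>lebesgue_on \<Omega>) = 0"
  shows "AE t in lebesgue_on \<Omega>. u t = w t"
proof -
  have 1: "AE t in lebesgue_on \<Omega>. u t * ln (u t / w t) - u t + w t = 0"
    using assms integral_nonneg_eq_0_iff_AE[OF integrable_kl AE_kl_nonneg] by simp
  have 2: "AE t in lebesgue_on \<Omega>. 0 \<le> u t"
    using u by (simp add: dom_entropy_iff)
  show ?thesis
    using 1 2 dom_subdiff_entropy_pos[OF w] by eventually_elim (rule kl_eq_0_imp_eq)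
qed

end

section \<open>Exponential reweighting of an iterate\<close>

text \<open>Taking logarithms of \<open>weq\<close> gives
  \<open>ln (u / v) = ln (u / w) + ln s + l * g\<close> where \<open>u > 0\<close>. After
  multiplication by \<open>c * u\<close>, the relation \<open>c * l = 1\<close> makes the term with
  \<open>g\<close> cancel. Besides the divergence from \<open>w\<close>, the right side depends on
  \<open>u\<close> only through its total mass.\<close>

lemma three_point_identity:
  fixes u v w g :: "real ^ 'd \<Rightarrow> real"
  assumes u: "u \<in> dom_entropy \<Omega>" and v: "v \<in> dom_subdiff_entropy \<Omega>" and w: "w \<in> dom_subdiff_entropy \<Omega>"
    and g: "g \<in> Linf \<Omega>" and s: "0 < s" and c: "c * l = 1"
    and weq: "\<And>t. w t = v t * s * exp (l * g t)"
  shows "c * (\<integral>t. u t * ln (u t / v t) - u t + v t \<partial>lebesgue_on \<Omega>) - (\<integral>t. u t * g t \<partial>lebesgue_on \<Omega>)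
    = c * (\<integral>t. u t * ln (u t / w t) - u t + w t \<partial>lebesgue_on \<Omega>)
      + c * (\<integral>t. v t - w t \<partial>lebesgue_on \<Omega>) + c * ln s * (\<integral>t. u t \<partial>lebesgue_on \<Omega>)"
    (is "?l = ?r")
proof -
  let ?M = "lebesgue_on \<Omega>"
  have int: "integrable ?M u" "integrable ?M v" "integrable ?M w"
    using u v w by (auto simp: dom_entropy_iff dom_subdiff_entropy_def L1_def)
  note int = int integrable_kl[OF u v] integrable_kl[OF u w] integrable_mult_Linf[OF int(1) g]
  have "?l = (\<integral>t. c * (u t * ln (u t / v t) - u t + v t) - u t * g t \<partial>?M)"
    using int by simp
  also have "\<dots> = (\<integral>t. c * (u t * ln (u t / w t) - u t + w t) + c * (v t - w t) + c * ln s * u t \<partial>?M)"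
  proof (rule integral_cong_AE)
    have "AE t in ?M. 0 \<le> u t"
      using u by (simp add: dom_entropy_iff)
    then show "AE t in ?M. c * (u t * ln (u t / v t) - u t + v t) - u t * g t
        = c * (u t * ln (u t / w t) - u t + w t) + c * (v t - w t) + c * ln s * u t"
      using dom_subdiff_entropy_pos[OF v]
    proof eventually_elim
      case (elim t)
      have "c * (u t * ln (u t / v t)) - u t * g t = c * (u t * ln (u t / w t)) + c * ln s * u t"
      proof (cases "u t = 0")
        case False
        with elim have lv: "ln (u t / v t) = ln (u t) - ln (v t)"
          by (simp add: ln_div)
        have lw: "ln (u t / w t) = ln (u t) - (ln (v t) + ln s + l * g t)"
          using False elim s by (simp add: weq ln_div ln_mult)
        have "c * (u t * ln (u t / v t)) - c * (u t * ln (u t / w t)) - c * ln s * u t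
            = (c * l) * u t * g t"
          unfolding lv lw by (simp add: algebra_simps)
        then show ?thesis
          by (simp add: c)
      qed simp
      then show ?case
        by (simp add: algebra_simps)
    qed
  qed (use int in \<open>auto intro!: borel_measurable_integrable\<close>)
  also have "\<dots> = ?r"
    using int by simp
  finally show ?thesis .
qed

text \<open>A zero integral would make \<open>f\<close> both zero and positive almost everywhere,
  which is impossible on a space of nonzero measure. It guarantees that the normalising integral can
  be inverted.\<close>

lemma integral_pos_of_AE_pos:
  fixes f :: "'a \<Rightarrow> real"
  assumes "integrable M f" and "AE x in M. 0 < f x" and "emeasure M (space M) \<noteq> 0"
  shows "0 < (\<integral>x. f x \<partial>M)"
proof -
  have nn: "AE x in M. 0 \<le> f x"
    using assms(2) by (auto elim: eventually_mono)
  have "(\<integral>x. f x \<partial>M) \<noteq> 0"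
  proof
    assume "(\<integral>x. f x \<partial>M) = 0"
    then have "AE x in M. f x = 0"
      using integral_nonneg_eq_0_iff_AE[OF assms(1) nn] by simp
    with assms(2) have "AE x in M. False"
      by eventually_elim simp
    with assms(3) show False
      by (simp add: AE_iff_measurable[OF sets.top])
  qed
  with integral_nonneg_AE[OF nn] show ?thesis
    by linarith
qed

text \<open>If \<open>\<bar>g\<bar> \<le> C\<close>, the exponential lies between
  \<open>exp (- (\<bar>l\<bar> * C))\<close> and its reciprocal, and these bounds multiply with
  those of \<open>v\<close>.\<close>

lemma mult_exp_dom_subdiff_entropy:
  fixes s l :: real
  assumes v: "v \<in> dom_subdiff_entropy \<Omega>" and g: "g \<in> Linf \<Omega>" and s: "0 < s"
  shows "(\<lambda>t. v t * s * exp (l * g t)) \<in> dom_subdiff_entropy \<Omega>"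
proof -
  from v obtain \<alpha> \<beta> where \<alpha>: "0 < \<alpha>" and \<beta>: "AE t in lebesgue_on \<Omega>. \<alpha> \<le> v t \<and> v t \<le> \<beta>"
    and vi: "integrable (lebesgue_on \<Omega>) v"
    by (auto simp: dom_subdiff_entropy_def L1_def)
  from g obtain C where C: "AE t in lebesgue_on \<Omega>. \<bar>g t\<bar> \<le> C"
    and [measurable]: "g \<in> borel_measurable (lebesgue_on \<Omega>)"
    by (auto simp: Linf_def)
  have E: "AE t in lebesgue_on \<Omega>. exp (- (\<bar>l\<bar> * C)) \<le> exp (l * g t) \<and> exp (l * g t) \<le> exp (\<bar>l\<bar> * C)"
    using C
  proof eventually_elim
    case (elim t)
    then have "\<bar>l * g t\<bar> \<le> \<bar>l\<bar> * C"
      by (simp add: abs_mult mult_left_mono)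
    then show ?case
      by (simp add: abs_le_iff)
  qed
  have "integrable (lebesgue_on \<Omega>) (\<lambda>t. v t * (s * exp (l * g t)))"
  proof (rule integrable_mult_AE_bounded[OF vi])
    show "AE t in lebesgue_on \<Omega>. \<bar>s * exp (l * g t)\<bar> \<le> s * exp (\<bar>l\<bar> * C)"
      using E s by (auto elim: eventually_mono simp: abs_mult)
  qed simp
  moreover have "AE t in lebesgue_on \<Omega>. \<alpha> * s * exp (- (\<bar>l\<bar> * C)) \<le> v t * s * exp (l * g t) \<and>
      v t * s * exp (l * g t) \<le> \<beta> * s * exp (\<bar>l\<bar> * C)"
    using E \<beta>
  proof eventually_elim
    case (elim t)
    then show ?case
      using \<alpha> s by (intro conjI mult_mono) auto
  qed
  moreover have "0 < \<alpha> * s * exp (- (\<bar>l\<bar> * C))"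
    using \<alpha> s by simp
  ultimately show ?thesis
    unfolding dom_subdiff_entropy_def L1_def mult.assoc by blast
qed

section \<open>Existence, uniqueness and iteration of the step\<close>

text \<open>A single step from an arbitrary admissible \<open>v\<close>. The first and third claims
  together show that every minimizer is again admissible, which lets the step be iterated.\<close>

lemma unique_step:
  fixes A :: "((real ^ 'd) \<Rightarrow> real) \<Rightarrow> 'y::real_inner" and \<Omega> :: "(real ^ 'd) set"
    and y :: 'y and m :: nat
  assumes fin: "finite_measure (lebesgue_on \<Omega>)" and pos: "emeasure (lebesgue_on \<Omega>) \<Omega> \<noteq> 0"
    and A: "bounded_linear_L1 \<Omega> A" and c: "c > 0" and l: "l = 1 / c"
    and v: "v \<in> dom_subdiff_entropy \<Omega>"
  defines "w \<equiv> \<lambda>t. v t * step_const \<Omega> A y l m v * exp (l * adjoint_L1 \<Omega> A (y - A v) t)"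
  shows "w \<in> dom_subdiff_entropy \<Omega>" and "is_step \<Omega> A y c m v w"
    and "is_step \<Omega> A y c m v u \<Longrightarrow> AE t in lebesgue_on \<Omega>. u t = w t"
proof -
  let ?M = "lebesgue_on \<Omega>"
  define z where "z = y - A v"
  define g where "g = adjoint_L1 \<Omega> A z"
  define s where "s = step_const \<Omega> A y l m v"
  have w_eq: "w t = v t * s * exp (l * g t)" for t
    by (simp add: w_def s_def g_def z_def)
  have g: "g \<in> Linf \<Omega>"
    unfolding g_def by (rule adjoint_L1(1)[OF fin A])
  \<comment> \<open>The unnormalised update is treated first, with factor 1: for nonzero
    \<open>m\<close>, \<open>s\<close> is the reciprocal of its integral, so positivity of
    \<open>s\<close> depends on it.\<close>
  have ve: "(\<lambda>t. v t * exp (l * g t)) \<in> dom_subdiff_entropy \<Omega>"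
    using mult_exp_dom_subdiff_entropy[OF v g zero_less_one, of l] by simp
  have Z: "0 < (\<integral>t. v t * exp (l * g t) \<partial>?M)"
    using ve dom_subdiff_entropy_pos[OF ve] pos
    by (intro integral_pos_of_AE_pos) (auto simp: dom_subdiff_entropy_def L1_def)
  have s: "0 < s"
    using Z by (simp add: s_def step_const_def g_def z_def)
  show w: "w \<in> dom_subdiff_entropy \<Omega>"
    unfolding w_eq[abs_def] by (rule mult_exp_dom_subdiff_entropy[OF v g s])
  then have w': "w \<in> dom_entropy \<Omega>"
    using dom_subdiff_entropy_subset by blast
  have chi_w: "chi \<Omega> m w = 0"
  proof (cases "m = 0")
    case False
    then have "s = 1 / (\<integral>t. v t * exp (l * g t) \<partial>?M)"
      by (simp add: s_def step_const_def g_def z_def)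
    moreover have "(\<integral>t. w t \<partial>?M) = s * (\<integral>t. v t * exp (l * g t) \<partial>?M)"
      by (simp add: w_eq mult.assoc mult.left_commute flip: integral_mult_right_zero)
    ultimately show ?thesis
      using Z by (simp add: chi_def)
  qed (simp add: chi_def)
  define D where "D u = (\<integral>t. u t * ln (u t / w t) - u t + w t \<partial>?M)" for u
  define J where "J u = ereal ((A u - y) \<bullet> (A v - y)) + ereal c * enn2ereal (KL \<Omega> u v) + chi \<Omega> m u" for u
  \<comment> \<open>The part of the objective that is constant on the feasible set. The first term
    is left over from the inner product, \<open>y \<bullet> z - A u \<bullet> z\<close>. The last is
    \<open>c * ln s\<close> times the mass of \<open>u\<close>: for \<open>m = 0\<close> it is zero
    because \<open>s = 1\<close>, otherwise feasibility fixes the mass at 1.\<close>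
  define q where "q = y \<bullet> z + c * (\<integral>t. v t - w t \<partial>?M) + (if m = 0 then 0 else c * ln s)"
  have J: "J u = ereal (q + c * D u) + chi \<Omega> m u" if u: "u \<in> dom_entropy \<Omega>" for u
  proof (cases "chi \<Omega> m u = 0")
    case True
    have "(\<integral>t. u t * g t \<partial>?M) = A u \<bullet> z"
      unfolding g_def using u by (intro adjoint_L1(2)[OF fin A]) (simp add: dom_entropy_iff L1_def)
    moreover have "(A u - y) \<bullet> (A v - y) = y \<bullet> z - A u \<bullet> z"
      by (simp add: z_def inner_diff_left inner_diff_right)
    moreover have "c * ln s * (\<integral>t. u t \<partial>?M) = (if m = 0 then 0 else c * ln s)"
      using True by (auto simp: chi_def s_def step_const_def split: if_splits)
    ultimately have "(A u - y) \<bullet> (A v - y) + c * (\<integral>t. u t * ln (u t / v t) - u t + v t \<partial>?M) = q + c * D u"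
      using three_point_identity[OF u v w g s _ w_eq, of c] c l by (simp add: q_def D_def)
    then show ?thesis
      by (simp add: J_def KL_eq_integral[OF u v] True)
  next
    \<comment> \<open>For infeasible \<open>u\<close> both sides are infinite, the other summands
      being finite.\<close>
    case False
    then have "chi \<Omega> m u = \<infinity>"
      by (auto simp: chi_def split: if_splits)
    then show ?thesis
      by (simp add: J_def KL_eq_integral[OF u v])
  qed
  have "D w = 0"
  proof -
    have "AE t in ?M. w t * ln (w t / w t) - w t + w t = 0"
      using dom_subdiff_entropy_pos[OF w] by eventually_elim simp
    then show ?thesis
      unfolding D_def by (rule integral_eq_zero_AE)
  qed
  then have Jw: "J w = ereal q"
    by (simp add: J[OF w'] chi_w)
  have Jge: "ereal (q + c * D u) \<le> J u" if "u \<in> dom_entropy \<Omega>" for u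
    by (auto simp: J[OF that] chi_def)
  have Dnn: "0 \<le> D u" if "u \<in> dom_entropy \<Omega>" for u
    unfolding D_def by (rule integral_kl_nonneg[OF that w])
  \<comment> \<open>\<open>is_arg_min\<close> forbids strictly smaller values; since
    \<open>ereal\<close> is linearly ordered, this amounts to a lower bound.\<close>
  have step: "is_step \<Omega> A y c m v u \<longleftrightarrow> u \<in> dom_entropy \<Omega> \<and> (\<forall>u'\<in>dom_entropy \<Omega>. J u \<le> J u')" for u
    unfolding is_step_def is_arg_min_def J_def[symmetric] by (meson not_less)
  have "J w \<le> J u" if "u \<in> dom_entropy \<Omega>" for u
  proof -
    have "ereal q \<le> ereal (q + c * D u)"
      using Dnn[OF that] c by simp
    with Jge[OF that] show ?thesis
      unfolding Jw by (rule order_trans[rotated])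
  qed
  then show "is_step \<Omega> A y c m v w"
    by (simp add: step w')
  show "AE t in ?M. u t = w t" if "is_step \<Omega> A y c m v u"
  proof -
    have u: "u \<in> dom_entropy \<Omega>" and "J u \<le> J w"
      using that w' by (auto simp: step)
    \<comment> \<open>A competing minimizer cannot exceed the value \<open>q\<close> attained at
      \<open>w\<close>, so its divergence from \<open>w\<close> is at most, hence exactly,
      zero.\<close>
    then have "ereal (q + c * D u) \<le> ereal q"
      unfolding Jw using Jge[OF u] by (blast intro: order_trans)
    then have "c * D u \<le> 0"
      by simp
    with Dnn[OF u] c have "D u = 0"
      by (simp add: mult_le_0_iff)
    then show ?thesis
      unfolding D_def by (rule integral_kl_eq_0_imp_AE_eq[OF u w])
  qed
qed

theorem proposition3p1:
  fixes \<Omega> :: "(real ^ 'd) set"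
    and A :: "((real ^ 'd) \<Rightarrow> real) \<Rightarrow> 'y::{real_inner, complete_space}"
    and y :: 'y
    and c l :: real
    and m k :: nat
    and u :: "nat \<Rightarrow> (real ^ 'd) \<Rightarrow> real"
  assumes "open \<Omega>" and "bounded \<Omega>" and "\<Omega> \<noteq> {}"
    and "bounded_linear_L1 \<Omega> A"
    and "c > 0" and "l = 1 / c"
    and "m \<in> {0, 1}"
    and "u 0 \<in> dom_subdiff_entropy \<Omega>"
    and "\<forall>j<k. is_step \<Omega> A y c m (u j) (u (Suc j))"
  shows "\<exists>w. is_step \<Omega> A y c m (u k) w
     \<and> (\<forall>v. is_step \<Omega> A y c m (u k) v \<longrightarrow> (AE t in lebesgue_on \<Omega>. v t = w t))
     \<and> (AE t in lebesgue_on \<Omega>.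
          w t = u k t * step_const \<Omega> A y l m (u k) * exp (l * adjoint_L1 \<Omega> A (y - A (u k)) t))
     \<and> w \<in> dom_subdiff_entropy \<Omega>"
proof -
  have fin: "finite_measure (lebesgue_on \<Omega>)"
    using \<open>open \<Omega>\<close> \<open>bounded \<Omega>\<close>
    by (intro finite_measure_lebesgue_on bounded_set_imp_lmeasurable) (auto intro: borel_open)
  \<comment> \<open>A nonempty open set is not negligible; this supplies the nonzero measure behind
    the normalisation.\<close>
  have pos: "emeasure (lebesgue_on \<Omega>) \<Omega> \<noteq> 0"
  proof
    assume "emeasure (lebesgue_on \<Omega>) \<Omega> = 0"
    then have "\<Omega> \<in> null_sets lebesgue"
      using \<open>open \<Omega>\<close> by (auto simp: emeasure_restrict_space null_sets_def borel_open)
    then show False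
      using open_not_negligible[OF \<open>open \<Omega>\<close> \<open>\<Omega> \<noteq> {}\<close>] by (simp add: negligible_iff_null_sets)
  qed
  note unique_step = unique_step[OF fin pos \<open>bounded_linear_L1 \<Omega> A\<close> \<open>c > 0\<close> \<open>l = 1 / c\<close>]
  \<comment> \<open>Each given iterate is some minimizer, so by uniqueness it agrees almost
    everywhere with the explicit formula and inherits its bounds.\<close>
  have "u k \<in> dom_subdiff_entropy \<Omega>"
    using \<open>\<forall>j<k. is_step \<Omega> A y c m (u j) (u (Suc j))\<close>
  proof (induction k)
    case 0
    show ?case by (rule \<open>u 0 \<in> dom_subdiff_entropy \<Omega>\<close>)
  next
    case (Suc k)
    then have uk: "u k \<in> dom_subdiff_entropy \<Omega>" and step: "is_step \<Omega> A y c m (u k) (u (Suc k))"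
      by auto
    from step have "u (Suc k) \<in> L1 \<Omega>"
      by (simp add: is_step_def is_arg_min_def dom_entropy_def)
    then show ?case
      by (rule dom_subdiff_entropy_cong_AE[OF unique_step(1)[OF uk] _ unique_step(3)[OF uk step]])
  qed
  from unique_step[OF this, of y m] show ?thesis
    by (intro exI[of _ "\<lambda>t. u k t * step_const \<Omega> A y l m (u k) * exp (l * adjoint_L1 \<Omega> A (y - A (u k)) t)"])
      auto
qed

end
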